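(* Let $\theta>0$ be a real number. Then the function $$F(x) \ := \ \log \binom{x+\frac{\theta}{x}}{x}$$ of the real variable $x>0$ is increasing on the interval $(0,\sqrt{\theta}]$.
   Context: For real numbers $x$ and $y$ (chosen such that the arguments of the gamma function below avoid non-positive integers), the binomial coefficient is defined via Euler's gamma function $\Gamma$ by $$\binom{x+y}{x} \, = \, \frac{\Gamma(x+y+1)}{\Gamma(x+1)\,\Gamma(y+1)} \, .$$ Thus, with $y=\theta/x$, $F(x)=\log\Gamma\left(x+\frac{\theta}{x}+1\right)-\log\Gamma(x+1)-\log\Gamma\left(\frac{\theta}{x}+1\right)$ for $x>0$. *)

theory Defs
  imports "HOL-Analysis.Gamma_Function"
begin

text \<open>
  The library's \<open>gchoose\<close> only takes natural lower arguments, so the binomial coefficient with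
  real arguments is defined here. It is meaningful when none of \<open>a + 1\<close>, \<open>b + 1\<close>, \<open>a - b + 1\<close> is
  a non-positive integer; at such poles the library sets \<open>Gamma\<close> to 0.
\<close>

definition real_binomial :: "real \<Rightarrow> real \<Rightarrow> real" where
  "real_binomial a b = Gamma (a + 1) / (Gamma (b + 1) * Gamma (a - b + 1))"

lemma real_binomial_add:
  "real_binomial (x + y) x = Gamma (x + y + 1) / (Gamma (x + 1) * Gamma (y + 1))"
  by (simp add: real_binomial_def)

lemma real_binomial_of_nat:
  assumes "k \<le> n"
  shows "real_binomial (real n) (real k) = real (n choose k)"
proof -
  have G: "Gamma (real m + 1) = fact m" for m
    using Gamma_fact[of m, where 'a = real] by (simp add: add.commute)
  have "real_binomial (real n) (real k) = fact n / (fact k * fact (n - k))"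
    using assms G[of "n - k"] by (simp add: real_binomial_def G of_nat_diff)
  also have "\<dots> = real (n choose k)"
    using assms by (simp add: binomial_fact)
  finally show ?thesis .
qed

end

theory Submission
  imports Defs
begin

text \<open>
  Euler's limit for the Gamma function turns the binomial coefficient into the infinite product of
  the factors \<open>1 + x * y / (k * (k + x + y))\<close> over \<open>k \<ge> 1\<close>. With \<open>x * y = \<theta>\<close> fixed, each factor
  depends on \<open>x\<close> only through \<open>x + y = x + \<theta> / x\<close>, which strictly decreases on \<open>(0, sqrt \<theta>]\<close>, so
  each factor strictly increases. Keeping the ratio of the factors \<open>k = 1\<close> as a constant
  greater than 1 preserves strictness in the limit.
\<close>

lemma real_binomial_pos:
  assumes "a > -1" "b > -1" "a - b > -1"
  shows "real_binomial a b > 0"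
  using assms by (simp add: real_binomial_def)

text \<open>The hypotheses keep all three Gamma arguments positive. For each \<open>n > 0\<close>
  the quotient of the three approximating sequences equals the finite product exactly, so no error
  term arises.\<close>

lemma real_binomial_Euler_product:
  assumes "x > -1" "y > -1" "x + y > -1"
  shows "(\<lambda>n. \<Prod>k=1..n. 1 + x * y / (real k * (real k + (x + y))))
           \<longlonglongrightarrow> real_binomial (x + y) x"
proof -
  have eq: "Gamma_series' (x + y + 1) n / (Gamma_series' (x + 1) n * Gamma_series' (y + 1) n) =
      (\<Prod>k=1..n. 1 + x * y / (real k * (real k + (x + y))))" if "n > 0" for n
  proof -
    \<comment> \<open>\<open>Gamma_series'\<close> pairs \<open>fact (n - 1)\<close> with a
      Pochhammer symbol of \<open>n\<close> factors, so the shift by 1 gives exactly the indices 1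
      to \<open>n\<close>.\<close>
    have poch: "pochhammer (z + 1) n = (\<Prod>k=1..n. real k + z)" for z :: real
      unfolding pochhammer_prod_rev
      by (rule prod.reindex_bij_witness[of _ "\<lambda>k. n + 1 - k" "\<lambda>k. n + 1 - k"])
         (auto simp: of_nat_diff algebra_simps)
    have pos: "pochhammer (x + 1) n > 0" "pochhammer (y + 1) n > 0" "pochhammer (x + y + 1) n > 0"
      using assms by (auto intro!: pochhammer_pos)
    have fact: "fact n = real n * fact (n - 1)"
      using that by (simp add: fact_reduce)
    \<comment> \<open>The exponents differ by one in total; the surplus factor \<open>n\<close>
      turns the remaining \<open>fact (n - 1)\<close> into \<open>fact n\<close>.\<close>
    have power: "exp ((x + 1) * ln (real n)) * exp ((y + 1) * ln (real n)) =
        real n * exp ((x + y + 1) * ln (real n))"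
      using that by (simp add: algebra_simps exp_add)
    have "Gamma_series' (x + y + 1) n / (Gamma_series' (x + 1) n * Gamma_series' (y + 1) n) =
        fact (n - 1) * exp ((x + y + 1) * ln (real n)) *
          (pochhammer (x + 1) n * pochhammer (y + 1) n) /
        (pochhammer (x + y + 1) n * (fact (n - 1) * fact (n - 1) *
          (exp ((x + 1) * ln (real n)) * exp ((y + 1) * ln (real n)))))"
      using pos by (simp add: Gamma_series'_def field_simps)
    also have "\<dots> = pochhammer (x + 1) n * pochhammer (y + 1) n /
        (fact n * pochhammer (x + y + 1) n)"
      unfolding power fact using pos that by (simp add: field_simps)
    also have "\<dots> = (\<Prod>k=1..n. (real k + x) * (real k + y) / (real k * (real k + (x + y))))"
      by (simp add: poch fact_prod prod_dividef prod.distrib)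
    also have "\<dots> = (\<Prod>k=1..n. 1 + x * y / (real k * (real k + (x + y))))"
    proof (rule prod.cong)
      fix k assume "k \<in> {1..n}"
      then have "real k * (real k + (x + y)) \<noteq> 0"
        using assms by auto
      moreover have "(real k + x) * (real k + y) = real k * (real k + (x + y)) + x * y"
        by (simp add: algebra_simps)
      ultimately show "(real k + x) * (real k + y) / (real k * (real k + (x + y))) =
          1 + x * y / (real k * (real k + (x + y)))"
        by (simp only: add_divide_distrib divide_self if_False not_False_eq_True)
    qed simp
    finally show ?thesis .
  qed
  have "(\<lambda>n. Gamma_series' (x + y + 1) n / (Gamma_series' (x + 1) n * Gamma_series' (y + 1) n))
      \<longlonglongrightarrow> real_binomial (x + y) x"
    unfolding real_binomial_add using assms
    by (intro tendsto_intros Gamma_series'_LIMSEQ) (auto simp: Gamma_eq_zero_iff nonpos_Ints_def)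
  then show ?thesis
    by (rule Lim_transform_eventually)
       (use eq in \<open>auto intro: eventually_mono[OF eventually_gt_at_top[of 0]]\<close>)
qed

text \<open>For pairs of equal product only the sum enters the Euler factors, which separates the
  comparison of products from the behaviour of \<open>x + \<theta> / x\<close>.\<close>

lemma real_binomial_less:
  fixes x y u v :: real
  assumes "x > 0" "y > 0" "u > 0" "v > 0" "x * y = u * v" "u + v < x + y"
  shows "real_binomial (x + y) x < real_binomial (u + v) u"
proof -
  define \<theta> where "\<theta> = x * y"
  define g where "g s k = 1 + \<theta> / (real k * (real k + s))" for s k
  have \<theta>: "\<theta> > 0" "u * v = \<theta>"
    using assms by (simp_all add: \<theta>_def)
  \<comment> \<open>At \<open>k = 0\<close> division by zero yields 0, so the factor is 1.\<close>
  have g_pos: "g s k > 0" if "s > 0" for s k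
    using that \<theta> by (simp add: g_def add_pos_nonneg)
  have g_less: "g (x + y) k < g (u + v) k" if "k > 0" for k
    using that assms \<theta> by (auto simp: g_def intro!: divide_strict_left_mono mult_pos_pos add_pos_pos)
  define c where "c = g (u + v) 1 / g (x + y) 1"
  have c: "c > 1"
    using g_less[of 1] g_pos[of "x + y" 1] assms by (simp add: c_def)
  have lim: "(\<lambda>n. \<Prod>k=1..n. g (x + y) k) \<longlonglongrightarrow> real_binomial (x + y) x"
    "(\<lambda>n. \<Prod>k=1..n. g (u + v) k) \<longlonglongrightarrow> real_binomial (u + v) u"
    using real_binomial_Euler_product[of x y] real_binomial_Euler_product[of u v] assms(1-4)
    by (simp_all add: g_def \<theta>(2) flip: \<theta>_def)
  have le: "c * (\<Prod>k=1..n. g (x + y) k) \<le> (\<Prod>k=1..n. g (u + v) k)" if "n \<ge> 1" for n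
  proof -
    have split: "(\<Prod>k=1..n. g s k) = g s 1 * (\<Prod>k=2..n. g s k)" for s
      using that by (simp add: prod.atLeast_Suc_atMost numeral_2_eq_2)
    \<comment> \<open>Multiplying by \<open>c\<close> exchanges the first factor for its larger
      counterpart; the others are compared termwise.\<close>
    have "c * (\<Prod>k=1..n. g (x + y) k) = g (u + v) 1 * (\<Prod>k=2..n. g (x + y) k)"
      unfolding split c_def using g_pos[of "x + y" 1] assms by simp
    also have "\<dots> \<le> g (u + v) 1 * (\<Prod>k=2..n. g (u + v) k)"
      using g_pos[of "u + v" 1] g_pos[of "x + y"] assms
      by (intro mult_left_mono prod_mono) (auto intro!: less_imp_le g_less)
    finally show ?thesis
      by (simp only: split)
  qed
  have pos: "real_binomial (x + y) x > 0"
    using assms by (intro real_binomial_pos) auto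
  then have "real_binomial (x + y) x < c * real_binomial (x + y) x"
    using c by simp
  also have "\<dots> \<le> real_binomial (u + v) u"
    using le by (intro LIMSEQ_le[OF tendsto_mult_left[OF lim(1)] lim(2)]) blast
  finally show ?thesis .
qed

theorem theorem3:
  fixes \<theta> :: real
  assumes "\<theta> > 0"
  shows "strict_mono_on {0<..sqrt \<theta>} (\<lambda>x::real. ln (real_binomial (x + \<theta> / x) x))"
proof (rule strict_mono_onI)
  fix r s :: real
  assume "r \<in> {0<..sqrt \<theta>}" "s \<in> {0<..sqrt \<theta>}" and less: "r < s"
  then have rs: "0 < r" "0 < s" "s \<le> sqrt \<theta>"
    by auto
  then have quot: "\<theta> / r > 0" "\<theta> / s > 0"
    using assms by simp_all
  have "r * s < s * s"
    using rs less by simp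
  also have "\<dots> \<le> \<theta>"
    using mult_mono[of s "sqrt \<theta>" s "sqrt \<theta>"] rs assms by simp
  \<comment> \<open>This product is \<open>r * s\<close> times the difference of
    \<open>r + \<theta> / r\<close> and \<open>s + \<theta> / s\<close>.\<close>
  finally have "0 < (s - r) * (\<theta> - r * s)"
    using less by simp
  then have "s + \<theta> / s < r + \<theta> / r"
    using rs by (simp add: field_simps)
  then have "real_binomial (r + \<theta> / r) r < real_binomial (s + \<theta> / s) s"
    using rs quot by (intro real_binomial_less) simp_all
  moreover have "real_binomial (r + \<theta> / r) r > 0"
    using rs quot by (intro real_binomial_pos) linarith+
  ultimately show "ln (real_binomial (r + \<theta> / r) r) < ln (real_binomial (s + \<theta> / s) s)"
    by simp
qed

end
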